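(* Equip $\mathbb{R}^3$ with global coordinates $(x,y,t)$ and the Riemannian metric $ds^2=e^{2t}dx^2+e^{-2t}dy^2+dt^2$ (this is the model geometry $\mathbf{Sol}$). For $(a_2,a_3),(b_2,b_3)\in\mathbb{C}^2$ define $h_2,h_3:\mathbf{Sol}\to\mathbb{C}$ by $$h_2(x,y,t)=a_2(2x^2-e^{-2t})+a_3(2x^3-3xe^{-2t}),$$ $$h_3(x,y,t)=b_2(2y^2-e^{2t})+b_3(2y^3-3ye^{2t}).$$ Then the product $h_2\cdot h_3$ satisfies $$\tau(h_2\cdot h_3)=-8(a_2+3a_3x)(b_2+3b_3y)\quad\text{and}\quad \tau^2(h_2\cdot h_3)=0.$$ In particular, if $(a_2,a_3)\neq(0,0)$ and $(b_2,b_3)\neq(0,0)$, then $h_2\cdot h_3$ is a proper biharmonic function on $\mathbf{Sol}$.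
   Context: For a Riemannian manifold $(M,g)$, $\tau=\operatorname{div}\nabla$ denotes the Laplace-Beltrami operator acting on smooth complex-valued functions (the metric being extended complex-bilinearly), and $\tau^2(f)=\tau(\tau(f))$. A function $f:(M,g)\to\mathbb{C}$ is proper biharmonic if $\tau^2(f)=0$ and $\tau(f)$ does not vanish identically. On $\mathbf{Sol}$ the operator is $\tau(f)=e^{-2t}\frac{\partial^2 f}{\partial x^2}+e^{2t}\frac{\partial^2 f}{\partial y^2}+\frac{\partial^2 f}{\partial t^2}$. *)

theory Defs
  imports "HOL-Analysis.Analysis"
begin

definition partial_deriv ::
    "'n::finite \<Rightarrow> (real^'n \<Rightarrow> 'b::real_normed_vector) \<Rightarrow> real^'n \<Rightarrow> 'b" where
  "partial_deriv i f p = vector_derivative (\<lambda>s. f (p + s *\<^sub>R axis i 1)) (at 0)"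

primrec C_k :: "nat \<Rightarrow> (real^'n::finite \<Rightarrow> 'b::real_normed_vector) \<Rightarrow> bool" where
  "C_k 0 f \<longleftrightarrow> continuous_on UNIV f"
| "C_k (Suc k) f \<longleftrightarrow> (\<forall>p. f differentiable (at p)) \<and> (\<forall>i. C_k k (partial_deriv i f))"

definition smooth :: "(real^'n::finite \<Rightarrow> 'b::real_normed_vector) \<Rightarrow> bool" where
  "smooth f \<longleftrightarrow> (\<forall>k. C_k k f)"

text \<open>A Riemannian metric on the manifold \<open>real^'n\<close>, given by its matrix
  \<open>g p $ i $ j\<close> in the global coordinates.\<close>

definition riemannian_metric :: "(real^'n::finite \<Rightarrow> real^'n^'n) \<Rightarrow> bool" where
  "riemannian_metric g \<longleftrightarrow>
     smooth g \<and> (\<forall>p. transpose (g p) = g p) \<and> (\<forall>p v. v \<noteq> 0 \<longrightarrow> v \<bullet> (g p *v v) > 0)"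

text \<open>For complex-valued functions the gradient is a section of the complexified tangent
  bundle: the metric is extended complex-bilinearly, so the real inverse matrix acts on the
  complex partial derivatives without any conjugation.\<close>

definition grad ::
    "(real^'n::finite \<Rightarrow> real^'n^'n) \<Rightarrow> (real^'n \<Rightarrow> complex) \<Rightarrow> real^'n \<Rightarrow> complex^'n" where
  "grad g f p =
     (\<chi> i. \<Sum>j\<in>UNIV. complex_of_real (matrix_inv (g p) $ i $ j) * partial_deriv j f p)"

definition divergence ::
    "(real^'n::finite \<Rightarrow> real^'n^'n) \<Rightarrow> (real^'n \<Rightarrow> complex^'n) \<Rightarrow> real^'n \<Rightarrow> complex" where
  "divergence g X p =
     (\<Sum>i\<in>UNIV. partial_deriv i (\<lambda>q. complex_of_real (sqrt (det (g q))) * X q $ i) p)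
       / complex_of_real (sqrt (det (g p)))"

definition laplace_beltrami ::
    "(real^'n::finite \<Rightarrow> real^'n^'n) \<Rightarrow> (real^'n \<Rightarrow> complex) \<Rightarrow> real^'n \<Rightarrow> complex" where
  "laplace_beltrami g f = divergence g (grad g f)"

definition proper_biharmonic ::
    "(real^'n::finite \<Rightarrow> real^'n^'n) \<Rightarrow> (real^'n \<Rightarrow> complex) \<Rightarrow> bool" where
  "proper_biharmonic g f \<longleftrightarrow>
     smooth f \<and> (\<forall>p. laplace_beltrami g (laplace_beltrami g f) p = 0)
       \<and> \<not> (\<forall>p. laplace_beltrami g f p = 0)"

text \<open>On \<open>real^3\<close> the global coordinates are \<open>(x, y, t) = (p $ 1, p $ 2, p $ 3)\<close>.\<close>

definition sol_metric :: "real^3 \<Rightarrow> real^3^3" where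
  "sol_metric p = vector [vector [exp (2 * p $ 3), 0, 0],
                          vector [0, exp (- 2 * p $ 3), 0],
                          vector [0, 0, 1]]"

definition sol_h2 :: "complex \<Rightarrow> complex \<Rightarrow> real^3 \<Rightarrow> complex" where
  "sol_h2 a2 a3 p = (let x = p $ 1; t = p $ 3 in
     a2 * complex_of_real (2 * x^2 - exp (- 2 * t))
     + a3 * complex_of_real (2 * x^3 - 3 * x * exp (- 2 * t)))"

definition sol_h3 :: "complex \<Rightarrow> complex \<Rightarrow> real^3 \<Rightarrow> complex" where
  "sol_h3 b2 b3 p = (let y = p $ 2; t = p $ 3 in
     b2 * complex_of_real (2 * y^2 - exp (2 * t))
     + b3 * complex_of_real (2 * y^3 - 3 * y * exp (2 * t)))"

lemma smooth_coinduct: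
  assumes "f \<in> S"
    and "\<And>f. f \<in> S \<Longrightarrow> (\<forall>p. f differentiable (at p)) \<and> (\<forall>i. partial_deriv i f \<in> S)"
  shows "smooth f"
proof -
  have "C_k k f" if "f \<in> S" for k f
    using that
  proof (induction k arbitrary: f)
    case 0
    then show ?case
      using assms(2) by (auto intro!: continuous_at_imp_continuous_on differentiable_imp_continuous_within)
  next
    case (Suc k)
    then show ?case using assms(2) by auto
  qed
  then show ?thesis using assms(1) by (simp add: smooth_def)
qed

lemma has_vector_derivative_line:
  assumes "(f has_derivative f') (at p)"
  shows "((\<lambda>s. f (p + s *\<^sub>R axis i 1)) has_vector_derivative f' (axis i 1)) (at 0)"
proof -
  have "((\<lambda>s. p + s *\<^sub>R axis i 1) has_derivative (\<lambda>s. s *\<^sub>R axis i 1)) (at 0)"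
    by (auto intro!: derivative_eq_intros)
  from has_derivative_compose[OF this, of f f'] assms
  have "((\<lambda>s. f (p + s *\<^sub>R axis i 1)) has_derivative (\<lambda>s. f' (s *\<^sub>R axis i 1))) (at 0)"
    by simp
  moreover have "f' (s *\<^sub>R axis i 1) = s *\<^sub>R f' (axis i 1)" for s
    using assms by (simp add: has_derivative_linear linear_scale)
  ultimately show ?thesis by (simp add: has_vector_derivative_def)
qed

lemma partial_deriv_eq:
  assumes "(f has_derivative f') (at p)"
  shows "partial_deriv i f p = f' (axis i 1)"
  unfolding partial_deriv_def
  by (rule vector_derivative_at[OF has_vector_derivative_line[OF assms]])

lemma partial_deriv_line:
  assumes "f differentiable (at p)"
  shows "((\<lambda>s. f (p + s *\<^sub>R axis i 1)) has_vector_derivative partial_deriv i f p) (at 0)"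
  using assms has_vector_derivative_line partial_deriv_eq unfolding differentiable_def by metis

lemma riemannian_metric_sol: "riemannian_metric sol_metric"
proof -
  define F :: "real^3^3 \<Rightarrow> real^3^3 \<Rightarrow> real^3^3 \<Rightarrow> real^3 \<Rightarrow> real^3^3" where
    "F = (\<lambda>A B C p. exp (2 * p $ 3) *\<^sub>R A + exp (- 2 * p $ 3) *\<^sub>R B + C)"
  define S where "S = {f. \<exists>A B C. f = F A B C}"
  have F_in: "F A B C \<in> S" for A B C
    unfolding S_def by blast
  have hd: "(F A B C has_derivative (\<lambda>v. (exp (2 * p $ 3) * (2 * v $ 3)) *\<^sub>R A
      + (exp (- 2 * p $ 3) * (- 2 * v $ 3)) *\<^sub>R B)) (at p)" for A B C p
    unfolding F_def by (auto intro!: derivative_eq_intros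
        bounded_linear.has_derivative[OF bounded_linear_vec_nth] simp: fun_eq_iff mult_ac)
  have pd: "partial_deriv i (F A B C)
      = F ((if i = 3 then 2 else 0) *\<^sub>R A) ((if i = 3 then -2 else 0) *\<^sub>R B) 0" for i A B C
  proof
    fix p :: "real^3"
    show "partial_deriv i (F A B C) p =
        F ((if i = 3 then 2 else 0) *\<^sub>R A) ((if i = 3 then -2 else 0) *\<^sub>R B) 0 p"
      unfolding partial_deriv_eq[OF hd] by (simp add: axis_def F_def)
  qed
  have closed: "(\<forall>p. f differentiable (at p)) \<and> (\<forall>i. partial_deriv i f \<in> S)" if "f \<in> S" for f
  proof -
    obtain A B C where f: "f = F A B C" using \<open>f \<in> S\<close> unfolding S_def by blast
    show ?thesis
      unfolding f differentiable_def pd using hd F_in by blast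
  qed
  have "sol_metric = F (vector [vector [1, 0, 0], vector [0, 0, 0], vector [0, 0, 0]])
        (vector [vector [0, 0, 0], vector [0, 1, 0], vector [0, 0, 0]])
        (vector [vector [0, 0, 0], vector [0, 0, 0], vector [0, 0, 1]])"
    by (simp add: F_def sol_metric_def fun_eq_iff vec_eq_iff forall_3)
  then have "sol_metric \<in> S" by (rule ssubst) (rule F_in)
  then have "smooth sol_metric" using closed by (rule smooth_coinduct)
  moreover have "transpose (sol_metric p) = sol_metric p" for p
    by (simp add: transpose_def sol_metric_def vec_eq_iff forall_3)
  moreover have "v \<bullet> (sol_metric p *v v) > 0" if "v \<noteq> 0" for p v
  proof -
    have eq: "v \<bullet> (sol_metric p *v v)
        = exp (2 * p $ 3) * (v $ 1)\<^sup>2 + exp (- 2 * p $ 3) * (v $ 2)\<^sup>2 + (v $ 3)\<^sup>2"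
      by (simp add: inner_vec_def matrix_vector_mult_def sol_metric_def sum_3 power2_eq_square)
    from that have "v $ 1 \<noteq> 0 \<or> v $ 2 \<noteq> 0 \<or> v $ 3 \<noteq> 0"
      by (auto simp: vec_eq_iff forall_3)
    then have "exp (2 * p $ 3) * (v $ 1)\<^sup>2 > 0 \<or> exp (- 2 * p $ 3) * (v $ 2)\<^sup>2 > 0 \<or> (v $ 3)\<^sup>2 > 0"
      by auto
    moreover have "exp (2 * p $ 3) * (v $ 1)\<^sup>2 \<ge> 0" "exp (- 2 * p $ 3) * (v $ 2)\<^sup>2 \<ge> 0" "(v $ 3)\<^sup>2 \<ge> 0"
      by simp_all
    ultimately show ?thesis unfolding eq by linarith
  qed
  ultimately show ?thesis by (simp add: riemannian_metric_def)
qed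

lemma matrix_inv_eqI:
  fixes A B :: "real^'n::finite^'n"
  assumes "A ** B = mat 1" "B ** A = mat 1"
  shows "matrix_inv A = B"
  unfolding matrix_inv_def
proof (rule some_equality)
  show "A ** B = mat 1 \<and> B ** A = mat 1" using assms by blast
next
  fix C assume "A ** C = mat 1 \<and> C ** A = mat 1"
  then show "C = B" using assms by (metis matrix_mul_assoc matrix_mul_lid matrix_mul_rid)
qed

lemma laplace_beltrami_sol:
  fixes f :: "real^3 \<Rightarrow> complex"
  assumes "smooth f"
  shows "laplace_beltrami sol_metric f p =
    exp (- 2 * p $ 3) * partial_deriv 1 (partial_deriv 1 f) p
    + exp (2 * p $ 3) * partial_deriv 2 (partial_deriv 2 f) p
    + partial_deriv 3 (partial_deriv 3 f) p"
proof -
  have det: "det (sol_metric q) = 1" for q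
    by (simp add: det_3 sol_metric_def flip: exp_add)
  have inv: "matrix_inv (sol_metric q) = vector [vector [exp (- 2 * q $ 3), 0, 0],
      vector [0, exp (2 * q $ 3), 0], vector [0, 0, 1]]" for q
    by (rule matrix_inv_eqI)
       (simp_all add: matrix_matrix_mult_def sol_metric_def mat_def vec_eq_iff forall_3 sum_3
         flip: exp_add)
  have "C_k (Suc (Suc 0)) f" using assms unfolding smooth_def by blast
  then have "partial_deriv i f differentiable (at p)" for i by simp
  note d = partial_deriv_line[OF this]
  have pd: "partial_deriv i (\<lambda>q. complex_of_real (c (q $ 3)) * partial_deriv i f q) p
      = c (p $ 3) * partial_deriv i (partial_deriv i f) p" if "i \<noteq> 3" for i :: 3 and c
  proof -
    have "(axis i 1 :: real^3) $ 3 = 0"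
      using that by (simp add: axis_def)
    then show ?thesis
      using has_vector_derivative_mult_right[OF d[of i i], of "complex_of_real (c (p $ 3))"]
      unfolding partial_deriv_def[of i "\<lambda>q. complex_of_real (c (q $ 3)) * partial_deriv i f q"]
      by (simp add: vector_derivative_at)
  qed
  show ?thesis
    using pd[of 1 "\<lambda>t. exp (- 2 * t)"] pd[of 2 "\<lambda>t. exp (2 * t)"]
    by (simp add: laplace_beltrami_def divergence_def grad_def det inv sum_3)
qed

end

theory Submission
  imports Defs
begin

text \<open>
  The functions \<open>h_2\<close> and \<open>h_3\<close> are both harmonic on Sol, so the Leibniz rule
  \<open>\<tau>(f g) = \<tau>(f) g + f \<tau>(g) + 2 \<langle>\<nabla>f, \<nabla>g\<rangle>\<close> leaves only the mixed term.  Since \<open>h_2\<close> depends on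
  \<open>x, t\<close> only and \<open>h_3\<close> on \<open>y, t\<close> only, that term is \<open>2 (\<partial>\<^sub>t h_2) (\<partial>\<^sub>t h_3)\<close>.  The factors are
  \<open>\<partial>\<^sub>t h_2 = 2 e\<^bsup>-2t\<^esup> (a_2 + 3 a_3 x)\<close> and \<open>\<partial>\<^sub>t h_3 = -2 e\<^bsup>2t\<^esup> (b_2 + 3 b_3 y)\<close>:
  the exponentials cancel, and what remains is affine in \<open>x\<close> and in \<open>y\<close> and free of \<open>t\<close>, hence harmonic
  (\<open>laplace_beltrami_sol_affine_mult\<close>).  It is not identically zero because an affine function
  of one real variable with a nonzero coefficient does not vanish at both \<open>0\<close> and \<open>1\<close>.

  The coordinate formula for \<open>\<tau>\<close> and the Leibniz rule hold for smooth functions, and smoothness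
  is here a statement about all iterated partial derivatives; the closure of smoothness under
  sums and products is therefore an induction on the order of differentiability.
\<close>

section \<open>Calculus of partial derivatives\<close>

lemma partial_deriv_add:
  assumes "f differentiable (at p)" "g differentiable (at p)"
  shows "partial_deriv i (\<lambda>p. f p + g p) p = partial_deriv i f p + partial_deriv i g p"
proof -
  obtain f' g' where d: "(f has_derivative f') (at p)" "(g has_derivative g') (at p)"
    using assms unfolding differentiable_def by blast
  show ?thesis
    unfolding partial_deriv_eq[OF has_derivative_add[OF d]] partial_deriv_eq[OF d(1)]
      partial_deriv_eq[OF d(2)] ..
qed

lemma partial_deriv_mult:
  fixes f g :: "real^'n::finite \<Rightarrow> 'b::real_normed_algebra"
  assumes "f differentiable (at p)" "g differentiable (at p)"
  shows "partial_deriv i (\<lambda>p. f p * g p) p = f p * partial_deriv i g p + partial_deriv i f p * g p"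
proof -
  obtain f' g' where d: "(f has_derivative f') (at p)" "(g has_derivative g') (at p)"
    using assms unfolding differentiable_def by blast
  show ?thesis
    unfolding partial_deriv_eq[OF has_derivative_mult[OF d]] partial_deriv_eq[OF d(1)]
      partial_deriv_eq[OF d(2)] ..
qed

lemma partial_deriv_const: "partial_deriv i (\<lambda>p. c) = (\<lambda>p. 0)"
  using partial_deriv_eq[OF has_derivative_const] by (auto simp: fun_eq_iff)

lemma has_derivative_coord:
  "((\<lambda>p :: real^'n::finite. complex_of_real (p $ j)) has_derivative (\<lambda>v. complex_of_real (v $ j))) (at p)"
  by (intro has_derivative_of_real bounded_linear.has_derivative[OF bounded_linear_vec_nth]
      has_derivative_ident)

lemma has_derivative_exp_coord:
  "((\<lambda>p :: real^'n::finite. complex_of_real (exp (c * p $ j))) has_derivative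
     (\<lambda>v. complex_of_real (c * v $ j * exp (c * p $ j)))) (at p)"
  by (rule has_derivative_of_real)
     (auto intro!: derivative_eq_intros bounded_linear.has_derivative[OF bounded_linear_vec_nth]
       simp: fun_eq_iff)

section \<open>The algebra of smooth functions\<close>

lemma C_k_SucD: "C_k (Suc k) f \<Longrightarrow> C_k k f"
proof (induction k arbitrary: f)
  case 0
  then show ?case
    by (auto intro!: continuous_at_imp_continuous_on differentiable_imp_continuous_within)
next
  case (Suc k)
  then show ?case by (metis C_k.simps(2))
qed

lemma C_k_add:
  "C_k k f \<Longrightarrow> C_k k g \<Longrightarrow> C_k k (\<lambda>p. f p + g p)"
proof (induction k arbitrary: f g)
  case 0
  then show ?case by (auto intro: continuous_on_add)
next
  case (Suc k)
  then have "partial_deriv i (\<lambda>p. f p + g p) = (\<lambda>p. partial_deriv i f p + partial_deriv i g p)" for i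
    by (intro ext partial_deriv_add) auto
  with Suc show ?case by simp
qed

text \<open>The Leibniz rule multiplies a factor by a derivative of the other, which is one order less
  regular; \<open>C_k_SucD\<close> brings both to the same order, where the induction hypothesis applies.\<close>

lemma C_k_mult:
  fixes f g :: "real^'n::finite \<Rightarrow> 'b::real_normed_algebra"
  shows "C_k k f \<Longrightarrow> C_k k g \<Longrightarrow> C_k k (\<lambda>p. f p * g p)"
proof (induction k arbitrary: f g)
  case 0
  then show ?case by (auto intro: continuous_on_mult)
next
  case (Suc k)
  then have "partial_deriv i (\<lambda>p. f p * g p)
      = (\<lambda>p. f p * partial_deriv i g p + partial_deriv i f p * g p)" for i
    by (intro ext partial_deriv_mult) auto
  moreover have "C_k k f" "C_k k g" using Suc.prems by (auto dest: C_k_SucD simp del: C_k.simps)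
  ultimately show ?case using Suc by (auto intro!: C_k_add differentiable_mult)
qed

lemma smooth_add: "smooth f \<Longrightarrow> smooth g \<Longrightarrow> smooth (\<lambda>p. f p + g p)"
  by (simp add: smooth_def C_k_add)

lemma smooth_mult:
  fixes f g :: "real^'n::finite \<Rightarrow> 'b::real_normed_algebra"
  shows "smooth f \<Longrightarrow> smooth g \<Longrightarrow> smooth (\<lambda>p. f p * g p)"
  by (simp add: smooth_def C_k_mult)

lemma smooth_partial_deriv: "smooth f \<Longrightarrow> smooth (partial_deriv i f)"
  unfolding smooth_def by (metis C_k.simps(2))

lemma smooth_differentiable: "smooth f \<Longrightarrow> f differentiable (at p)"
  unfolding smooth_def by (metis C_k.simps(2))

lemma smooth_const: "smooth (\<lambda>p. c)"
  by (rule smooth_coinduct[where S = "range (\<lambda>c p. c)"]) (auto simp: partial_deriv_const)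

lemma smooth_coord: "smooth (\<lambda>p :: real^'n::finite. complex_of_real (p $ j))"
proof -
  have "partial_deriv i (\<lambda>p :: real^'n. complex_of_real (p $ j))
      = (\<lambda>p. complex_of_real (axis i 1 $ j))" for i
    using partial_deriv_eq[OF has_derivative_coord] by (auto simp: fun_eq_iff)
  moreover have "(\<lambda>p :: real^'n. complex_of_real (p $ j)) differentiable (at p)" for p
    using has_derivative_coord differentiable_def by blast
  ultimately have "C_k (Suc k) (\<lambda>p :: real^'n. complex_of_real (p $ j))" for k
    using smooth_const by (auto simp: smooth_def)
  then show ?thesis unfolding smooth_def using C_k_SucD by blast
qed

text \<open>A partial derivative of an exponential is a multiple of the same exponential, so the
  complex multiples of it form a set of differentiable functions closed under differentiation.\<close>

lemma smooth_exp_coord: "smooth (\<lambda>p :: real^'n::finite. complex_of_real (exp (c * p $ j)))"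
proof (rule smooth_coinduct[where S = "range (\<lambda>k p. k * complex_of_real (exp (c * p $ j)))"])
  show "(\<lambda>p. complex_of_real (exp (c * p $ j)))
      \<in> range (\<lambda>k p. k * complex_of_real (exp (c * p $ j)))"
    by (rule range_eqI[where x = 1]) simp
next
  fix f :: "real^'n \<Rightarrow> complex"
  assume "f \<in> range (\<lambda>k p. k * complex_of_real (exp (c * p $ j)))"
  then obtain k where f: "f = (\<lambda>p. k * complex_of_real (exp (c * p $ j)))" by blast
  note d = has_derivative_mult_right[OF has_derivative_exp_coord, of k c j]
  have "partial_deriv i f
      = (\<lambda>p. (k * complex_of_real (c * axis i 1 $ j)) * complex_of_real (exp (c * p $ j)))" for i
    unfolding f using partial_deriv_eq[OF d] by (auto simp: fun_eq_iff)
  then have "partial_deriv i f \<in> range (\<lambda>k p. k * complex_of_real (exp (c * p $ j)))" for i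
    by (rule range_eqI)
  moreover have "f differentiable (at p)" for p
    unfolding f using d differentiable_def by blast
  ultimately show "(\<forall>p. f differentiable (at p))
      \<and> (\<forall>i. partial_deriv i f \<in> range (\<lambda>k p. k * complex_of_real (exp (c * p $ j))))"
    by blast
qed

section \<open>The Laplace-Beltrami operator of Sol on products\<close>

lemma partial_deriv_partial_deriv_mult:
  fixes f g :: "real^'n::finite \<Rightarrow> complex"
  assumes "smooth f" "smooth g"
  shows "partial_deriv i (partial_deriv i (\<lambda>p. f p * g p)) p =
    partial_deriv i (partial_deriv i f) p * g p + f p * partial_deriv i (partial_deriv i g) p
    + 2 * (partial_deriv i f p * partial_deriv i g p)"
proof -
  note s = assms smooth_partial_deriv[OF assms(1), of i] smooth_partial_deriv[OF assms(2), of i]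
  have "partial_deriv i (\<lambda>p. f p * g p)
      = (\<lambda>p. f p * partial_deriv i g p + partial_deriv i f p * g p)"
    using partial_deriv_mult smooth_differentiable s by blast
  then show ?thesis
    using s by (simp add: partial_deriv_add partial_deriv_mult smooth_differentiable smooth_mult
        algebra_simps)
qed

lemma laplace_beltrami_sol_mult:
  fixes f g :: "real^3 \<Rightarrow> complex"
  assumes "smooth f" "smooth g"
  shows "laplace_beltrami sol_metric (\<lambda>p. f p * g p) p =
    laplace_beltrami sol_metric f p * g p + f p * laplace_beltrami sol_metric g p
    + 2 * (exp (- 2 * p $ 3) * (partial_deriv 1 f p * partial_deriv 1 g p)
         + exp (2 * p $ 3) * (partial_deriv 2 f p * partial_deriv 2 g p)
         + partial_deriv 3 f p * partial_deriv 3 g p)"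
  unfolding laplace_beltrami_sol[OF assms(1)] laplace_beltrami_sol[OF assms(2)]
    laplace_beltrami_sol[OF smooth_mult[OF assms]] partial_deriv_partial_deriv_mult[OF assms]
  by (simp add: algebra_simps)

lemma smooth_affine_mult:
  "smooth (\<lambda>p :: real^3. c * (a + a' * complex_of_real (p $ 1)) * (b + b' * complex_of_real (p $ 2)))"
  by (intro smooth_mult smooth_add smooth_const smooth_coord)

lemma laplace_beltrami_sol_affine_mult:
  "laplace_beltrami sol_metric
     (\<lambda>p. c * (a + a' * complex_of_real (p $ 1)) * (b + b' * complex_of_real (p $ 2))) p = 0"
proof -
  let ?f = "\<lambda>p :: real^3. c * (a + a' * complex_of_real (p $ 1)) * (b + b' * complex_of_real (p $ 2))"
  have "(?f has_derivative (\<lambda>v. c * (a' * complex_of_real (v $ 1)) * (b + b' * complex_of_real (p $ 2))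
      + c * (a + a' * complex_of_real (p $ 1)) * (b' * complex_of_real (v $ 2)))) (at p)" for p
    by (rule derivative_eq_intros has_derivative_coord refl)+ (simp add: fun_eq_iff algebra_simps)
  note pd = partial_deriv_eq[OF this]
  have pd1: "partial_deriv 1 ?f = (\<lambda>p. (c * a') * (b + b' * complex_of_real (p $ 2)))"
    and pd2: "partial_deriv 2 ?f = (\<lambda>p. (c * b') * (a + a' * complex_of_real (p $ 1)))"
    and pd3: "partial_deriv 3 ?f = (\<lambda>p. 0)"
    by (simp_all add: pd axis_def fun_eq_iff)
  have "((\<lambda>p. k * (d + e * complex_of_real (p $ j))) has_derivative
      (\<lambda>v. k * (e * complex_of_real (v $ j)))) (at p)"
    for j :: 3 and k d e p
    by (rule derivative_eq_intros has_derivative_coord refl)+ (simp add: fun_eq_iff)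
  note aff = partial_deriv_eq[OF this]
  show ?thesis
    unfolding laplace_beltrami_sol[OF smooth_affine_mult] pd1 pd2 pd3 aff partial_deriv_const
    by (simp add: axis_def)
qed

section \<open>The two harmonic factors\<close>

text \<open>The isometry \<open>(x, y, t) \<mapsto> (y, x, -t)\<close> of Sol exchanges the two families of factors, so
  both are instances of one formula: \<open>j = 1\<close>, \<open>c = -2\<close> for \<open>h_2\<close> and \<open>j = 2\<close>, \<open>c = 2\<close> for
  \<open>h_3\<close>.\<close>

definition sol_factor :: "3 \<Rightarrow> real \<Rightarrow> complex \<Rightarrow> complex \<Rightarrow> real^3 \<Rightarrow> complex" where
  "sol_factor j c a b p =
     a * (2 * (complex_of_real (p $ j))\<^sup>2 - complex_of_real (exp (c * p $ 3)))
     + b * (2 * (complex_of_real (p $ j)) ^ 3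
         - 3 * complex_of_real (p $ j) * complex_of_real (exp (c * p $ 3)))"

lemma sol_h2_eq: "sol_h2 a2 a3 = sol_factor 1 (-2) a2 a3"
  by (simp add: sol_h2_def sol_factor_def Let_def fun_eq_iff)

lemma sol_h3_eq: "sol_h3 b2 b3 = sol_factor 2 2 b2 b3"
  by (simp add: sol_h3_def sol_factor_def Let_def fun_eq_iff)

lemma smooth_sol_factor: "smooth (sol_factor j c a b)"
proof -
  have "sol_factor j c a b = (\<lambda>p.
      a * (2 * (complex_of_real (p $ j) * complex_of_real (p $ j))
        + (-1) * complex_of_real (exp (c * p $ 3)))
      + b * (2 * (complex_of_real (p $ j) * (complex_of_real (p $ j) * complex_of_real (p $ j)))
        + (-3) * (complex_of_real (p $ j) * complex_of_real (exp (c * p $ 3)))))"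
    by (simp add: sol_factor_def fun_eq_iff power2_eq_square power3_eq_cube)
  then show ?thesis
    by (simp only:) (intro smooth_add smooth_mult smooth_const smooth_coord smooth_exp_coord)
qed

lemma has_derivative_sol_factor:
  "(sol_factor j c a b has_derivative (\<lambda>v.
      complex_of_real (v $ j) * (4 * a * complex_of_real (p $ j)
        + 3 * b * (2 * (complex_of_real (p $ j))\<^sup>2 - complex_of_real (exp (c * p $ 3))))
      - complex_of_real (v $ 3) * (complex_of_real c * complex_of_real (exp (c * p $ 3))
        * (a + 3 * b * complex_of_real (p $ j))))) (at p)"
  unfolding sol_factor_def[abs_def]
  by (rule derivative_eq_intros has_derivative_coord has_derivative_exp_coord refl)+
     (simp add: fun_eq_iff algebra_simps power2_eq_square)

lemma partial_deriv_sol_factor: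
  assumes "j \<noteq> 3"
  shows "partial_deriv i (sol_factor j c a b) = (\<lambda>p.
    if i = j then 4 * a * complex_of_real (p $ j)
        + 3 * b * (2 * (complex_of_real (p $ j))\<^sup>2 - complex_of_real (exp (c * p $ 3)))
    else if i = 3 then - complex_of_real c * complex_of_real (exp (c * p $ 3))
        * (a + 3 * b * complex_of_real (p $ j))
    else 0)"
  using assms by (auto simp: partial_deriv_eq[OF has_derivative_sol_factor] axis_def fun_eq_iff)

lemma partial_deriv2_sol_factor:
  assumes "j \<noteq> 3"
  shows "partial_deriv i (partial_deriv i (sol_factor j c a b)) p =
    (if i = j then 4 * (a + 3 * b * complex_of_real (p $ j))
     else if i = 3 then - (complex_of_real c)\<^sup>2 * complex_of_real (exp (c * p $ 3))
        * (a + 3 * b * complex_of_real (p $ j))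
     else 0)"
proof -
  have "((\<lambda>p. 4 * a * complex_of_real (p $ j)
        + 3 * b * (2 * (complex_of_real (p $ j))\<^sup>2 - complex_of_real (exp (c * p $ 3))))
      has_derivative (\<lambda>v. 4 * complex_of_real (v $ j) * (a + 3 * b * complex_of_real (p $ j))
        - 3 * b * complex_of_real (c * v $ 3 * exp (c * p $ 3)))) (at p)"
    by (rule derivative_eq_intros has_derivative_coord has_derivative_exp_coord refl)+
       (simp add: fun_eq_iff algebra_simps)
  note d1 = partial_deriv_eq[OF this]
  have "((\<lambda>p. - complex_of_real c * complex_of_real (exp (c * p $ 3))
        * (a + 3 * b * complex_of_real (p $ j)))
      has_derivative (\<lambda>v. - complex_of_real c * complex_of_real (exp (c * p $ 3))
          * (complex_of_real (c * v $ 3) * (a + 3 * b * complex_of_real (p $ j))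
             + 3 * b * complex_of_real (v $ j)))) (at p)"
    by (rule derivative_eq_intros has_derivative_coord has_derivative_exp_coord refl)+
       (simp add: fun_eq_iff algebra_simps)
  note d2 = partial_deriv_eq[OF this]
  consider "i = j" | "i = 3" | "i \<noteq> j" "i \<noteq> 3" by blast
  then show ?thesis
  proof cases
    case 1
    then show ?thesis
      using assms unfolding partial_deriv_sol_factor[OF assms] by (simp add: d1 axis_def)
  next
    case 2
    then show ?thesis
      using assms d2 unfolding partial_deriv_sol_factor[OF assms]
      by (simp add: axis_def power2_eq_square)
  next
    case 3
    then show ?thesis
      unfolding partial_deriv_sol_factor[OF assms] by (simp add: partial_deriv_const)
  qed
qed

text \<open>The values \<open>c = -2\<close> and \<open>c = 2\<close> are the exponents of the inverse metric in the
  directions \<open>x\<close> and \<open>y\<close>; since also \<open>c\<^sup>2 = 4\<close>, the second derivatives in \<open>x\<close> (or \<open>y\<close>) and \<open>t\<close>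
  cancel.\<close>

lemma laplace_beltrami_sol_h2: "laplace_beltrami sol_metric (sol_h2 a2 a3) p = 0"
  unfolding sol_h2_eq laplace_beltrami_sol[OF smooth_sol_factor]
  by (simp add: partial_deriv2_sol_factor)

lemma laplace_beltrami_sol_h3: "laplace_beltrami sol_metric (sol_h3 b2 b3) p = 0"
  unfolding sol_h3_eq laplace_beltrami_sol[OF smooth_sol_factor]
  by (simp add: partial_deriv2_sol_factor)

section \<open>The product is proper biharmonic\<close>

lemma laplace_beltrami_sol_h2_h3:
  "laplace_beltrami sol_metric (\<lambda>p. sol_h2 a2 a3 p * sol_h3 b2 b3 p) p =
    - 8 * (a2 + 3 * a3 * complex_of_real (p $ 1)) * (b2 + 3 * b3 * complex_of_real (p $ 2))"
proof -
  have smooth: "smooth (sol_h2 a2 a3)" "smooth (sol_h3 b2 b3)"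
    unfolding sol_h2_eq sol_h3_eq by (rule smooth_sol_factor)+
  have "complex_of_real (exp (- 2 * p $ 3)) * complex_of_real (exp (2 * p $ 3)) = 1"
    by (simp flip: of_real_mult exp_add)
  then have "partial_deriv 3 (sol_h2 a2 a3) p * partial_deriv 3 (sol_h3 b2 b3) p =
      - 4 * ((a2 + 3 * a3 * complex_of_real (p $ 1)) * (b2 + 3 * b3 * complex_of_real (p $ 2)))"
    unfolding sol_h2_eq sol_h3_eq by (simp add: partial_deriv_sol_factor)
  moreover have "partial_deriv 2 (sol_h2 a2 a3) p = 0" "partial_deriv 1 (sol_h3 b2 b3) p = 0"
    unfolding sol_h2_eq sol_h3_eq by (simp_all add: partial_deriv_sol_factor)
  ultimately show ?thesis
    unfolding laplace_beltrami_sol_mult[OF smooth] laplace_beltrami_sol_h2 laplace_beltrami_sol_h3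
    by (simp only: mult_zero_left mult_zero_right add_0_left) (simp add: algebra_simps)
qed

lemma affine_nonzero_value:
  fixes a b :: complex
  assumes "(a, b) \<noteq> (0, 0)"
  obtains x :: real where "a + 3 * b * complex_of_real x \<noteq> 0"
proof (cases "a = 0")
  case True
  then show ?thesis using assms that[of 1] by simp
next
  case False
  then show ?thesis using that[of 0] by simp
qed

theorem mainTheorem2:
  fixes a2 a3 b2 b3 :: complex
  shows "(\<forall>p. laplace_beltrami sol_metric (\<lambda>p. sol_h2 a2 a3 p * sol_h3 b2 b3 p) p =
            - 8 * (a2 + 3 * a3 * complex_of_real (p $ 1)) * (b2 + 3 * b3 * complex_of_real (p $ 2)))
       \<and> (\<forall>p. laplace_beltrami sol_metric
                (laplace_beltrami sol_metric (\<lambda>p. sol_h2 a2 a3 p * sol_h3 b2 b3 p)) p = 0)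
       \<and> ((a2, a3) \<noteq> (0, 0) \<and> (b2, b3) \<noteq> (0, 0) \<longrightarrow>
            proper_biharmonic sol_metric (\<lambda>p. sol_h2 a2 a3 p * sol_h3 b2 b3 p))"
proof (intro conjI allI impI)
  let ?h = "\<lambda>p. sol_h2 a2 a3 p * sol_h3 b2 b3 p"
  note tau = laplace_beltrami_sol_h2_h3[of a2 a3 b2 b3]
  show "laplace_beltrami sol_metric ?h p =
      - 8 * (a2 + 3 * a3 * complex_of_real (p $ 1)) * (b2 + 3 * b3 * complex_of_real (p $ 2))" for p
    by (rule tau)
  show tau2: "laplace_beltrami sol_metric (laplace_beltrami sol_metric ?h) p = 0" for p
    unfolding tau[abs_def] by (rule laplace_beltrami_sol_affine_mult)
  assume "(a2, a3) \<noteq> (0, 0) \<and> (b2, b3) \<noteq> (0, 0)"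
  then obtain x y :: real
    where xy: "a2 + 3 * a3 * complex_of_real x \<noteq> 0" "b2 + 3 * b3 * complex_of_real y \<noteq> 0"
    using affine_nonzero_value by metis
  have "laplace_beltrami sol_metric ?h (vector [x, y, 0]) \<noteq> 0"
    using xy unfolding tau vector_3 mult_eq_0_iff by auto
  moreover have "smooth ?h"
    unfolding sol_h2_eq sol_h3_eq by (intro smooth_mult smooth_sol_factor)
  ultimately show "proper_biharmonic sol_metric ?h"
    unfolding proper_biharmonic_def using tau2 by blast
qed

end
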